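(* Let $n$ be a positive integer. For $\gamma_1,\gamma_2:S^n\to\mathbb{R}_+$ continuous, define $\gamma_{max}(\theta)=\max\{\gamma_1(\theta),\gamma_2(\theta)\}$ and $\gamma_{min}(\theta)=\min\{\gamma_1(\theta),\gamma_2(\theta)\}$ for $\theta\in S^n$. (i) If $\gamma_1$ and $\gamma_2$ are convex integrands, then \[\mathcal{W}_{\gamma_{max}}=\mathcal{D}\left(\mathcal{D}\mathcal{W}_{\gamma_1}\cap\mathcal{D}\mathcal{W}_{\gamma_2}\right).\] (ii) If $\gamma_1$ and $\gamma_2$ are continuous functions, then \[\mathcal{W}_{\gamma_{min}}=\mathcal{D}\left(\text{convex hull of }\left(\mathcal{D}\mathcal{W}_{\gamma_1}\cup\mathcal{D}\mathcal{W}_{\gamma_2}\right)\right).\]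
   Context: $S^n$ is the unit sphere in $\mathbb{R}^{n+1}$ and $\mathbb{R}_+$ is the set of positive real numbers. For a continuous function $\gamma:S^n\to\mathbb{R}_+$, the Wulff shape associated with $\gamma$ is $\mathcal{W}_\gamma=\bigcap_{\theta\in S^n}\{x\in\mathbb{R}^{n+1}\mid x\cdot\theta\le\gamma(\theta)\}$, where $\cdot$ is the dot product. A Wulff shape is a convex compact set containing the origin as an interior point, and conversely every such set is a Wulff shape $\mathcal{W}_\gamma$ for some continuous $\gamma$. Write $\mathrm{graph}(\gamma)=\{(\theta,\gamma(\theta))\mid\theta\in S^n\}\subset\mathbb{R}^{n+1}\setminus\{0\}$ in polar plot expression, i.e. $(\theta,r)$ with $\theta\in S^n$, $r>0$ denotes the point $r\theta\in\mathbb{R}^{n+1}\setminus\{0\}$. The inversion $\mathrm{inv}:\mathbb{R}^{n+1}\setminus\{0\}\to\mathbb{R}^{n+1}\setminus\{0\}$ is $\mathrm{inv}(\theta,r)=(-\theta,1/r)$. A continuous function $\gamma:S^n\to\mathbb{R}_+$ is called a convex integrand if $\mathrm{inv}(\mathrm{graph}(\gamma))$ equals the boundary of the convex hull of $\mathrm{inv}(\mathrm{graph}(\gamma))$. Dual Wulff shape. For $\widetilde P\in S^{n+1}\subset\mathbb{R}^{n+2}$ let $H(\widetilde P)=\{\widetilde Q\in S^{n+1}\mid\widetilde P\cdot\widetilde Q\ge0\}$, and for non-empty $\widetilde W\subset S^{n+1}$ let $\widetilde W^\circ=\bigcap_{\widetilde P\in\widetilde W}H(\widetilde P)$ (spherical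 polar set). Let $N=(0,\dots,0,1)\in\mathbb{R}^{n+2}$, $S^{n+1}_{N,+}=S^{n+1}\setminus H(-N)$, $Id:\mathbb{R}^{n+1}\to\mathbb{R}^{n+1}\times\{1\}$, $Id(x)=(x,1)$, and let $\alpha_N:S^{n+1}_{N,+}\to\mathbb{R}^{n+1}\times\{1\}$ be the central projection $\alpha_N(P_1,\dots,P_{n+2})=(P_1/P_{n+2},\dots,P_{n+1}/P_{n+2},1)$. The dual Wulff shape of a Wulff shape $\mathcal{W}\subset\mathbb{R}^{n+1}$ is \[\mathcal{D}\mathcal{W}=Id^{-1}\circ\alpha_N\left(\left(\alpha_N^{-1}\circ Id(\mathcal{W})\right)^\circ\right),\] which is known to be again a Wulff shape. *)

theory Defs
  imports "HOL-Analysis.Analysis"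
begin

text \<open>
  The space $R^{n+1}$ is a type \<open>'a :: euclidean_space\<close> of dimension $n+1$, and $R^{n+2}$ is
  \<open>'a \<times> real\<close> with the library's product inner product, the last coordinate being the
  second component. A function $S^n \to R_+$ is a total function \<open>'a \<Rightarrow> real\<close>, only its values on
  \<open>sphere 0 1\<close> being used.
\<close>

definition wulff_shape :: "('a::euclidean_space \<Rightarrow> real) \<Rightarrow> 'a set"
  where "wulff_shape \<gamma> = (\<Inter>\<theta>\<in>sphere 0 1. {x. x \<bullet> \<theta> \<le> \<gamma> \<theta>})"

definition polar_graph :: "('a::euclidean_space \<Rightarrow> real) \<Rightarrow> 'a set"
  where "polar_graph \<gamma> = {\<gamma> \<theta> *\<^sub>R \<theta> | \<theta>. \<theta> \<in> sphere 0 1}"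

text \<open>
  A nonzero \<open>x\<close> has polar coordinates \<open>(sgn x, norm x)\<close>, so this is
  $(\theta, r) \mapsto (-\theta, 1/r)$. The value at \<open>0\<close> is irrelevant.
\<close>

definition inversion :: "'a::euclidean_space \<Rightarrow> 'a"
  where "inversion x = (1 / norm x) *\<^sub>R (- sgn x)"

definition convex_integrand :: "('a::euclidean_space \<Rightarrow> real) \<Rightarrow> bool"
  where "convex_integrand \<gamma> \<longleftrightarrow>
    continuous_on (sphere 0 1) \<gamma> \<and> \<gamma> ` sphere 0 1 \<subseteq> {0<..} \<and>
    inversion ` polar_graph \<gamma> = frontier (convex hull (inversion ` polar_graph \<gamma>))"

definition hemisphere :: "'b::euclidean_space \<Rightarrow> 'b set"
  where "hemisphere P = {Q \<in> sphere 0 1. P \<bullet> Q \<ge> 0}"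

definition spherical_polar :: "'b::euclidean_space set \<Rightarrow> 'b set"
  where "spherical_polar W = (\<Inter>P\<in>W. hemisphere P)"

definition north_pole :: "'a::euclidean_space \<times> real"
  where "north_pole = (0, 1)"

definition north_open_hemisphere :: "('a::euclidean_space \<times> real) set"
  where "north_open_hemisphere = sphere 0 1 - hemisphere (- north_pole)"

definition embed_one :: "'a::euclidean_space \<Rightarrow> 'a \<times> real"
  where "embed_one x = (x, 1)"

definition central_projection :: "'a::euclidean_space \<times> real \<Rightarrow> 'a \<times> real"
  where "central_projection P = (fst P /\<^sub>R snd P, 1)"

text \<open>
  The central projection is a map on the open hemisphere only; images and preimages under it are
  therefore taken inside that hemisphere. For a set with the origin in its interior the
  spherical polar set below is already contained in it.
\<close>

definition dual_wulff_shape :: "'a::euclidean_space set \<Rightarrow> 'a set"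
  where "dual_wulff_shape W =
    embed_one -` (central_projection `
      (spherical_polar (central_projection -` (embed_one ` W) \<inter> north_open_hemisphere)
        \<inter> north_open_hemisphere))"

end

theory Submission
  imports Defs
begin

text \<open>
  Homogeneity removes the sphere from the definition of the dual: in the affine chart, the dual
  of \<open>W\<close> is the negated polar set \<open>neg_polar W\<close> of all \<open>y\<close> with \<open>x \<bullet> y \<ge> -1\<close> for every \<open>x \<in> W\<close>.
  Likewise each half-space \<open>x \<bullet> \<theta> \<le> \<gamma> \<theta>\<close> says \<open>(- \<theta> / \<gamma> \<theta>) \<bullet> x \<ge> -1\<close>, so that the Wulff shape
  of \<open>\<gamma>\<close> is the negated polar of the inverted polar graph of \<open>\<gamma>\<close>
  (\<open>wulff_shape_eq_neg_polar\<close>). Everything then happens inside the Galois connection of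
  \<open>neg_polar\<close> with itself.

  For the minimum, the Wulff shape is the intersection of the two Wulff shapes, \<open>neg_polar\<close> turns
  unions into intersections and ignores convex hulls, and a Wulff shape, being a polar set, equals
  its own bidual.

  For the maximum, convexity of the integrand gives a supporting hyperplane at each point of the
  inverted graph. Hence the dual of the Wulff shape reaches exactly as far in each direction as
  the inverted graph does: it is the star-shaped set \<open>radial_fill \<gamma>\<close> bounded by that graph
  (\<open>bipolar_inverted_graph\<close>). Intersecting two such sets takes the smaller radius in each
  direction, that is, the larger of the two integrands; and filling the segments down
  to the origin does not change the polar.
\<close>


section \<open>Negated polar sets\<close>

definition neg_polar :: "'a::real_inner set \<Rightarrow> 'a set"
  where "neg_polar S = {y. \<forall>x\<in>S. - 1 \<le> x \<bullet> y}"

lemma neg_polar_antimono: "S \<subseteq> T \<Longrightarrow> neg_polar T \<subseteq> neg_polar S"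
  unfolding neg_polar_def by blast

lemma neg_polar_Un: "neg_polar (S \<union> T) = neg_polar S \<inter> neg_polar T"
  unfolding neg_polar_def by blast

lemma subset_neg_polar_neg_polar: "S \<subseteq> neg_polar (neg_polar S)"
  unfolding neg_polar_def by (auto simp: inner_commute)

lemma neg_polar_triple: "neg_polar (neg_polar (neg_polar S)) = neg_polar S"
  by (simp add: neg_polar_antimono subset_antisym subset_neg_polar_neg_polar)

text \<open>
  The points whose inner product with a fixed \<open>y\<close> is at least \<open>-1\<close> form a half-space, which
  contains the convex hull of a set as soon as it contains the set.
\<close>
lemma neg_polar_convex_hull: "neg_polar (convex hull S) = neg_polar S"
proof
  show "neg_polar (convex hull S) \<subseteq> neg_polar S"
    by (intro neg_polar_antimono hull_subset)
  show "neg_polar S \<subseteq> neg_polar (convex hull S)"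
  proof
    fix y assume "y \<in> neg_polar S"
    then have "S \<subseteq> {x. y \<bullet> x \<ge> - 1}"
      by (auto simp: neg_polar_def inner_commute)
    then have "convex hull S \<subseteq> {x. y \<bullet> x \<ge> - 1}"
      by (intro hull_minimal convex_halfspace_ge)
    then show "y \<in> neg_polar (convex hull S)"
      by (auto simp: neg_polar_def inner_commute)
  qed
qed

lemma neg_polar_scale:
  assumes "x \<in> neg_polar S" "0 \<le> t" "t \<le> 1"
  shows "t *\<^sub>R x \<in> neg_polar S"
proof -
  have "- 1 \<le> t * (z \<bullet> x)" if "z \<in> S" for z
  proof -
    have "t * (- 1) \<le> t * (z \<bullet> x)"
      using assms that by (intro mult_left_mono) (auto simp: neg_polar_def)
    then show ?thesis using assms by linarith
  qed
  then show ?thesis by (simp add: neg_polar_def)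
qed


section \<open>Duality in the affine chart\<close>

lemma mem_north_open_hemisphere:
  "P \<in> north_open_hemisphere \<longleftrightarrow> norm P = 1 \<and> 0 < snd P"
  by (cases P) (auto simp: north_open_hemisphere_def hemisphere_def north_pole_def)

lemma sgn_embed_one:
  fixes x :: "'a::euclidean_space"
  shows "sgn (embed_one x) \<in> north_open_hemisphere"
    and "central_projection (sgn (embed_one x)) = embed_one x"
proof -
  have "embed_one x \<noteq> 0"
    by (simp add: embed_one_def zero_prod_def)
  then have "0 < norm (embed_one x)" by simp
  then show "sgn (embed_one x) \<in> north_open_hemisphere"
    unfolding mem_north_open_hemisphere
    by (simp add: norm_sgn) (simp add: sgn_div_norm embed_one_def)
  show "central_projection (sgn (embed_one x)) = embed_one x"
    using \<open>0 < norm (embed_one x)\<close>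
    by (simp add: central_projection_def sgn_div_norm) (simp add: embed_one_def)
qed

text \<open>
  On the open hemisphere the last coordinates of \<open>P\<close> and \<open>Q\<close> are positive, so dividing by them
  keeps the sign of \<open>P \<bullet> Q\<close> and turns it into that of \<open>x \<bullet> y + 1\<close>.
\<close>
lemma hemisphere_iff_inner_chart:
  assumes "P \<in> north_open_hemisphere" "central_projection P = embed_one x"
    and "Q \<in> north_open_hemisphere" "central_projection Q = embed_one y"
  shows "Q \<in> hemisphere P \<longleftrightarrow> - 1 \<le> x \<bullet> y"
proof -
  have pos: "0 < snd P" "0 < snd Q" and "norm Q = 1"
    using assms by (auto simp: mem_north_open_hemisphere)
  have x: "x = fst P /\<^sub>R snd P" and y: "y = fst Q /\<^sub>R snd Q"
    using assms by (auto simp: central_projection_def embed_one_def)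
  have "fst P = snd P *\<^sub>R x" "fst Q = snd Q *\<^sub>R y"
    using pos by (auto simp: x y)
  then have "P \<bullet> Q = (snd P * snd Q) * (x \<bullet> y + 1)"
    by (simp add: inner_prod_def algebra_simps)
  moreover have "0 < snd P * snd Q"
    using pos by simp
  ultimately have "0 \<le> P \<bullet> Q \<longleftrightarrow> 0 \<le> x \<bullet> y + 1"
    by (metis mult.commute mult_zero_left mult_le_cancel_right_pos)
  then show ?thesis
    using \<open>norm Q = 1\<close> by (auto simp: hemisphere_def)
qed

lemma dual_wulff_shape_eq_neg_polar: "dual_wulff_shape W = neg_polar W"
proof (rule set_eqI)
  fix y :: 'a
  let ?lift = "central_projection -` (embed_one ` W) \<inter> north_open_hemisphere"
  have "y \<in> dual_wulff_shape W \<longleftrightarrow>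
      (\<exists>Q\<in>north_open_hemisphere. central_projection Q = embed_one y \<and> (\<forall>P\<in>?lift. Q \<in> hemisphere P))"
    unfolding dual_wulff_shape_def spherical_polar_def
    by (simp only: vimage_eq image_iff Bex_def Int_iff INT_iff eq_commute[of "embed_one y"]) blast
  also have "\<dots> \<longleftrightarrow> (\<forall>x\<in>W. - 1 \<le> x \<bullet> y)"
  proof
    assume "\<exists>Q\<in>north_open_hemisphere. central_projection Q = embed_one y \<and> (\<forall>P\<in>?lift. Q \<in> hemisphere P)"
    then obtain Q where Q: "Q \<in> north_open_hemisphere" "central_projection Q = embed_one y"
      "\<forall>P\<in>?lift. Q \<in> hemisphere P" by blast
    show "\<forall>x\<in>W. - 1 \<le> x \<bullet> y"
    proof
      fix x assume "x \<in> W"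
      then have "sgn (embed_one x) \<in> ?lift"
        using sgn_embed_one[of x] by simp
      with Q show "- 1 \<le> x \<bullet> y"
        using hemisphere_iff_inner_chart[OF sgn_embed_one[of x]] by blast
    qed
  next
    assume *: "\<forall>x\<in>W. - 1 \<le> x \<bullet> y"
    have "sgn (embed_one y) \<in> hemisphere P" if P: "P \<in> ?lift" for P
    proof -
      from P obtain x where "x \<in> W" "central_projection P = embed_one x" by auto
      with * P show ?thesis
        using hemisphere_iff_inner_chart[OF _ _ sgn_embed_one[of y]] by blast
    qed
    then show "\<exists>Q\<in>north_open_hemisphere. central_projection Q = embed_one y \<and> (\<forall>P\<in>?lift. Q \<in> hemisphere P)"
      using sgn_embed_one[of y] by blast
  qed
  finally show "y \<in> dual_wulff_shape W \<longleftrightarrow> y \<in> neg_polar W"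
    by (simp add: neg_polar_def)
qed


section \<open>Wulff shapes as polars of inverted graphs\<close>

lemma inversion_polar_graph:
  assumes "\<gamma> ` sphere 0 1 \<subseteq> {0<..}"
  shows "inversion ` polar_graph \<gamma> = (\<lambda>\<theta>. - (\<theta> /\<^sub>R \<gamma> \<theta>)) ` sphere 0 1"
proof -
  have "inversion (\<gamma> \<theta> *\<^sub>R \<theta>) = - (\<theta> /\<^sub>R \<gamma> \<theta>)" if "\<theta> \<in> sphere 0 1" for \<theta>
  proof -
    have "0 < \<gamma> \<theta>" using assms that by blast
    then show ?thesis
      using that by (simp add: inversion_def sgn_div_norm divide_inverse)
  qed
  moreover have "polar_graph \<gamma> = (\<lambda>\<theta>. \<gamma> \<theta> *\<^sub>R \<theta>) ` sphere 0 1"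
    by (auto simp: polar_graph_def)
  ultimately show ?thesis
    by (simp add: image_image)
qed

lemma wulff_shape_eq_neg_polar:
  assumes "\<gamma> ` sphere 0 1 \<subseteq> {0<..}"
  shows "wulff_shape \<gamma> = neg_polar (inversion ` polar_graph \<gamma>)"
proof -
  have "x \<bullet> \<theta> \<le> \<gamma> \<theta> \<longleftrightarrow> - 1 \<le> (- (\<theta> /\<^sub>R \<gamma> \<theta>)) \<bullet> x" if "\<theta> \<in> sphere 0 1" for x \<theta>
  proof -
    have "0 < \<gamma> \<theta>" using assms that by blast
    then show ?thesis
      by (simp add: inner_commute field_simps)
  qed
  then show ?thesis
    unfolding inversion_polar_graph[OF assms]
    by (auto simp: wulff_shape_def neg_polar_def)
qed

lemma wulff_shape_min:
  "wulff_shape (\<lambda>\<theta>. min (\<gamma>\<^sub>1 \<theta>) (\<gamma>\<^sub>2 \<theta>)) = wulff_shape \<gamma>\<^sub>1 \<inter> wulff_shape \<gamma>\<^sub>2"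
  by (auto simp: wulff_shape_def)


section \<open>Duals of Wulff shapes of convex integrands\<close>

text \<open>
  The star body whose radial function in the direction \<open>- \<theta>\<close> is \<open>1 / \<gamma> \<theta>\<close>; writing the bound as
  \<open>r * \<gamma> \<theta> \<le> 1\<close> makes intersections visible without division.
\<close>
definition radial_fill :: "('a::euclidean_space \<Rightarrow> real) \<Rightarrow> 'a set"
  where "radial_fill \<gamma> = {- (r *\<^sub>R \<theta>) | r \<theta>. \<theta> \<in> sphere 0 1 \<and> 0 \<le> r \<and> r * \<gamma> \<theta> \<le> 1}"

text \<open>
  Polar coordinates of a nonzero point are unique, and the origin lies in every such set; so
  membership can be tested in one direction \<open>\<theta>\<close> at a time.
\<close>
lemma radial_fill_iff:
  assumes "\<theta> \<in> sphere 0 1" "0 \<le> r"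
  shows "- (r *\<^sub>R \<theta>) \<in> radial_fill \<gamma> \<longleftrightarrow> r * \<gamma> \<theta> \<le> 1"
proof
  assume "- (r *\<^sub>R \<theta>) \<in> radial_fill \<gamma>"
  then obtain s \<phi> where s: "r *\<^sub>R \<theta> = s *\<^sub>R \<phi>" "\<phi> \<in> sphere 0 1" "0 \<le> s" "s * \<gamma> \<phi> \<le> 1"
    unfolding radial_fill_def by auto
  have "norm (r *\<^sub>R \<theta>) = norm (s *\<^sub>R \<phi>)" using s by simp
  then have "r = s" using \<open>\<phi> \<in> sphere 0 1\<close> \<open>0 \<le> s\<close> assms by simp
  show "r * \<gamma> \<theta> \<le> 1"
  proof (cases "r = 0")
    case False
    then have "\<theta> = \<phi>" using s \<open>r = s\<close> by simp
    then show ?thesis using s \<open>r = s\<close> by simp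
  qed simp
qed (use assms in \<open>auto simp: radial_fill_def\<close>)

lemma radial_fill_max:
  "radial_fill (\<lambda>\<theta>. max (\<gamma>\<^sub>1 \<theta>) (\<gamma>\<^sub>2 \<theta>)) = radial_fill \<gamma>\<^sub>1 \<inter> radial_fill \<gamma>\<^sub>2"
proof -
  have *: "r * max a b \<le> 1 \<longleftrightarrow> r * a \<le> 1 \<and> r * b \<le> 1" if "0 \<le> r" for r a b :: real
    using that by (simp add: max_mult_distrib_left)
  show ?thesis
  proof (intro set_eqI iffI)
    fix x assume "x \<in> radial_fill (\<lambda>\<theta>. max (\<gamma>\<^sub>1 \<theta>) (\<gamma>\<^sub>2 \<theta>))"
    then show "x \<in> radial_fill \<gamma>\<^sub>1 \<inter> radial_fill \<gamma>\<^sub>2"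
      unfolding radial_fill_def Int_iff mem_Collect_eq using * by blast
  next
    fix x assume x: "x \<in> radial_fill \<gamma>\<^sub>1 \<inter> radial_fill \<gamma>\<^sub>2"
    then obtain r \<theta> where "x = - (r *\<^sub>R \<theta>)" "\<theta> \<in> sphere 0 1" "0 \<le> r"
      unfolding radial_fill_def by auto
    with x show "x \<in> radial_fill (\<lambda>\<theta>. max (\<gamma>\<^sub>1 \<theta>) (\<gamma>\<^sub>2 \<theta>))"
      by (simp add: radial_fill_iff *)
  qed
qed

text \<open>
  The bipolar contains the origin and is star-shaped about it, so it contains every segment from
  the origin to the inverted graph.
\<close>
lemma radial_fill_subset_bipolar:
  assumes "\<gamma> ` sphere 0 1 \<subseteq> {0<..}"
  shows "radial_fill \<gamma> \<subseteq> neg_polar (neg_polar (inversion ` polar_graph \<gamma>))"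
proof
  fix x assume "x \<in> radial_fill \<gamma>"
  then obtain r \<theta> where x: "x = - (r *\<^sub>R \<theta>)" "\<theta> \<in> sphere 0 1" "0 \<le> r" "r * \<gamma> \<theta> \<le> 1"
    unfolding radial_fill_def by blast
  then have "0 < \<gamma> \<theta>" using assms by blast
  have "- (\<theta> /\<^sub>R \<gamma> \<theta>) \<in> neg_polar (neg_polar (inversion ` polar_graph \<gamma>))"
    using subset_neg_polar_neg_polar x by (fastforce simp: inversion_polar_graph[OF assms])
  then have "(r * \<gamma> \<theta>) *\<^sub>R - (\<theta> /\<^sub>R \<gamma> \<theta>) \<in> neg_polar (neg_polar (inversion ` polar_graph \<gamma>))"
    using x \<open>0 < \<gamma> \<theta>\<close> by (intro neg_polar_scale) auto
  moreover have "(r * \<gamma> \<theta>) *\<^sub>R - (\<theta> /\<^sub>R \<gamma> \<theta>) = x"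
    using x \<open>0 < \<gamma> \<theta>\<close> by simp
  ultimately show "x \<in> neg_polar (neg_polar (inversion ` polar_graph \<gamma>))"
    by simp
qed

lemma inverted_graph_subset_radial_fill:
  assumes "\<gamma> ` sphere 0 1 \<subseteq> {0<..}"
  shows "inversion ` polar_graph \<gamma> \<subseteq> radial_fill \<gamma>"
proof -
  have "- (\<theta> /\<^sub>R \<gamma> \<theta>) \<in> radial_fill \<gamma>" if "\<theta> \<in> sphere 0 1" for \<theta>
  proof -
    have "0 < \<gamma> \<theta>" using assms that by blast
    then show ?thesis
      using radial_fill_iff[OF that, of "inverse (\<gamma> \<theta>)" \<gamma>] by simp
  qed
  then show ?thesis by (auto simp: inversion_polar_graph[OF assms])
qed

lemma neg_polar_radial_fill:
  assumes "\<gamma> ` sphere 0 1 \<subseteq> {0<..}"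
  shows "neg_polar (radial_fill \<gamma>) = wulff_shape \<gamma>"
  unfolding wulff_shape_eq_neg_polar[OF assms]
proof
  show "neg_polar (radial_fill \<gamma>) \<subseteq> neg_polar (inversion ` polar_graph \<gamma>)"
    by (intro neg_polar_antimono inverted_graph_subset_radial_fill assms)
  show "neg_polar (inversion ` polar_graph \<gamma>) \<subseteq> neg_polar (radial_fill \<gamma>)"
    using neg_polar_antimono[OF radial_fill_subset_bipolar[OF assms]]
    by (simp add: neg_polar_triple)
qed

text \<open>
  A convex set with empty interior lies in a hyperplane, which then supports it at every point;
  otherwise its relative interior is its interior and the point is on the relative boundary.
\<close>
lemma supporting_hyperplane_not_interior:
  fixes S :: "'a::euclidean_space set"
  assumes "convex S" "p \<in> S" "p \<notin> interior S"
  obtains a where "a \<noteq> 0" "\<And>x. x \<in> S \<Longrightarrow> a \<bullet> x \<le> a \<bullet> p"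
proof (cases "interior S = {}")
  case True
  then obtain a b where "a \<noteq> 0" "S \<subseteq> {x. a \<bullet> x = b}"
    using empty_interior_subset_hyperplane[OF assms(1)] by metis
  then have "a \<bullet> x = a \<bullet> p" if "x \<in> S" for x
    using assms(2) that by blast
  then show ?thesis using that[of a] \<open>a \<noteq> 0\<close> by simp
next
  case False
  then have "p \<notin> rel_interior S"
    using assms(3) rel_interior_nonempty_interior by blast
  then obtain a where "a \<noteq> 0" "\<And>y. y \<in> S \<Longrightarrow> a \<bullet> p \<le> a \<bullet> y"
    using supporting_hyperplane_rel_boundary[OF assms(1,2)] by metis
  then show ?thesis using that[of "- a"] by simp
qed

text \<open>
  A supporting functional at a point \<open>p\<close> of the inverted graph, scaled to the value \<open>-1\<close> at \<open>p\<close>,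
  lies in the polar, and its value is below \<open>-1\<close> at every point beyond \<open>p\<close> on the same ray, so no
  such point is in the bipolar. The scaling is possible because the inverted graph meets every ray from the origin, so
  the supporting functional is positive somewhere on it and hence at its maximum \<open>p\<close>.
\<close>
lemma bipolar_inverted_graph:
  assumes "convex_integrand \<gamma>"
  shows "neg_polar (neg_polar (inversion ` polar_graph \<gamma>)) = radial_fill \<gamma>"
proof
  define C where "C = inversion ` polar_graph \<gamma>"
  have pos: "\<gamma> ` sphere 0 1 \<subseteq> {0<..}" and frontier: "C = frontier (convex hull C)"
    using assms by (auto simp: convex_integrand_def C_def)
  have C: "C = (\<lambda>\<theta>. - (\<theta> /\<^sub>R \<gamma> \<theta>)) ` sphere 0 1"
    unfolding C_def by (rule inversion_polar_graph[OF pos])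
  show "radial_fill \<gamma> \<subseteq> neg_polar (neg_polar (inversion ` polar_graph \<gamma>))"
    by (rule radial_fill_subset_bipolar[OF pos])
  show "neg_polar (neg_polar (inversion ` polar_graph \<gamma>)) \<subseteq> radial_fill \<gamma>"
    unfolding C_def[symmetric]
  proof
    fix z assume z: "z \<in> neg_polar (neg_polar C)"
    obtain \<theta> where \<theta>: "\<theta> \<in> sphere 0 1" "z = - (norm z *\<^sub>R \<theta>)"
    proof (cases "z = 0")
      case True
      obtain e :: 'a where "norm e = 1" using vector_choose_size[of 1] by auto
      with True show ?thesis by (intro that[of e]) auto
    next
      case False
      then show ?thesis
        by (intro that[of "- sgn z"]) (auto simp: norm_sgn sgn_div_norm)
    qed
    define p where "p = - (\<theta> /\<^sub>R \<gamma> \<theta>)"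
    have "0 < \<gamma> \<theta>" using pos \<theta> by blast
    have "p \<in> C" using \<theta> by (auto simp: C p_def)
    then have "p \<in> frontier (convex hull C)" using frontier by blast
    obtain a where "a \<noteq> 0" and a: "\<And>x. x \<in> convex hull C \<Longrightarrow> a \<bullet> x \<le> a \<bullet> p"
      using supporting_hyperplane_not_interior[OF convex_convex_hull, of p C]
        \<open>p \<in> C\<close> \<open>p \<in> frontier (convex hull C)\<close>
      by (auto simp: frontier_def hull_inc)
    have a_le: "a \<bullet> x \<le> a \<bullet> p" if "x \<in> C" for x
      using a that hull_subset by fast
    have "0 < a \<bullet> p"
    proof -
      have s: "- sgn a \<in> sphere 0 1" using \<open>a \<noteq> 0\<close> by (simp add: norm_sgn)
      then have "0 < \<gamma> (- sgn a)" using pos by blast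
      moreover have "0 < a \<bullet> sgn a"
        using \<open>a \<noteq> 0\<close> by (simp add: sgn_div_norm)
      ultimately have "0 < a \<bullet> - ((- sgn a) /\<^sub>R \<gamma> (- sgn a))"
        by simp
      also have "\<dots> \<le> a \<bullet> p"
        by (intro a_le) (unfold C, intro imageI s)
      finally show ?thesis .
    qed
    define y where "y = - (a /\<^sub>R (a \<bullet> p))"
    have "- 1 \<le> x \<bullet> y" if "x \<in> C" for x
      using a_le[OF that] \<open>0 < a \<bullet> p\<close>
      by (simp add: y_def inner_commute field_simps)
    then have "y \<in> neg_polar C" by (simp add: neg_polar_def)
    then have "- 1 \<le> y \<bullet> z" using z by (simp add: neg_polar_def)
    moreover have "(norm z * \<gamma> \<theta>) *\<^sub>R p = - (norm z *\<^sub>R \<theta>)"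
      using \<open>0 < \<gamma> \<theta>\<close> by (simp add: p_def)
    then have "z = (norm z * \<gamma> \<theta>) *\<^sub>R p"
      using \<theta> by metis
    then have "y \<bullet> z = (norm z * \<gamma> \<theta>) * (y \<bullet> p)"
      by (metis inner_scaleR_right)
    moreover have "y \<bullet> p = - 1"
      using \<open>0 < a \<bullet> p\<close> by (simp add: y_def)
    ultimately have "norm z * \<gamma> \<theta> \<le> 1" by simp
    then show "z \<in> radial_fill \<gamma>"
      using \<theta> radial_fill_iff[of \<theta> "norm z" \<gamma>] by (metis norm_ge_zero)
  qed
qed

lemma dual_wulff_shape_convex_integrand:
  assumes "convex_integrand \<gamma>"
  shows "dual_wulff_shape (wulff_shape \<gamma>) = radial_fill \<gamma>"
proof -
  have "\<gamma> ` sphere 0 1 \<subseteq> {0<..}" using assms by (simp add: convex_integrand_def)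
  then show ?thesis
    by (simp add: dual_wulff_shape_eq_neg_polar wulff_shape_eq_neg_polar
        bipolar_inverted_graph[OF assms])
qed


section \<open>Maximum and minimum of two integrands\<close>

theorem mainTheorem4:
  fixes n :: nat and \<gamma>\<^sub>1 \<gamma>\<^sub>2 :: "'a::euclidean_space \<Rightarrow> real"
  assumes "n \<ge> 1" and "DIM('a) = n + 1"
    and "continuous_on (sphere 0 1) \<gamma>\<^sub>1" and "\<gamma>\<^sub>1 ` sphere 0 1 \<subseteq> {0<..}"
    and "continuous_on (sphere 0 1) \<gamma>\<^sub>2" and "\<gamma>\<^sub>2 ` sphere 0 1 \<subseteq> {0<..}"
  shows "(convex_integrand \<gamma>\<^sub>1 \<and> convex_integrand \<gamma>\<^sub>2 \<longrightarrow>
           wulff_shape (\<lambda>\<theta>. max (\<gamma>\<^sub>1 \<theta>) (\<gamma>\<^sub>2 \<theta>)) =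
             dual_wulff_shape (dual_wulff_shape (wulff_shape \<gamma>\<^sub>1) \<inter> dual_wulff_shape (wulff_shape \<gamma>\<^sub>2)))
       \<and> wulff_shape (\<lambda>\<theta>. min (\<gamma>\<^sub>1 \<theta>) (\<gamma>\<^sub>2 \<theta>)) =
             dual_wulff_shape (convex hull
               (dual_wulff_shape (wulff_shape \<gamma>\<^sub>1) \<union> dual_wulff_shape (wulff_shape \<gamma>\<^sub>2)))"
proof (intro conjI impI)
  assume "convex_integrand \<gamma>\<^sub>1 \<and> convex_integrand \<gamma>\<^sub>2"
  then have "dual_wulff_shape (wulff_shape \<gamma>\<^sub>1) \<inter> dual_wulff_shape (wulff_shape \<gamma>\<^sub>2) =
      radial_fill (\<lambda>\<theta>. max (\<gamma>\<^sub>1 \<theta>) (\<gamma>\<^sub>2 \<theta>))"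
    by (simp add: dual_wulff_shape_convex_integrand radial_fill_max)
  moreover have "(\<lambda>\<theta>. max (\<gamma>\<^sub>1 \<theta>) (\<gamma>\<^sub>2 \<theta>)) ` sphere 0 1 \<subseteq> {0<..}"
    using assms(4) by (force simp: less_max_iff_disj)
  ultimately show "wulff_shape (\<lambda>\<theta>. max (\<gamma>\<^sub>1 \<theta>) (\<gamma>\<^sub>2 \<theta>)) =
      dual_wulff_shape (dual_wulff_shape (wulff_shape \<gamma>\<^sub>1) \<inter> dual_wulff_shape (wulff_shape \<gamma>\<^sub>2))"
    by (simp add: dual_wulff_shape_eq_neg_polar[of "radial_fill _"] neg_polar_radial_fill)
next
  show "wulff_shape (\<lambda>\<theta>. min (\<gamma>\<^sub>1 \<theta>) (\<gamma>\<^sub>2 \<theta>)) =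
      dual_wulff_shape (convex hull
        (dual_wulff_shape (wulff_shape \<gamma>\<^sub>1) \<union> dual_wulff_shape (wulff_shape \<gamma>\<^sub>2)))"
    unfolding dual_wulff_shape_eq_neg_polar neg_polar_convex_hull neg_polar_Un wulff_shape_min
    using assms(4,6) by (simp add: wulff_shape_eq_neg_polar neg_polar_triple)
qed

end
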